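(* Let $s\geq 5$ be an integer and $\tau\in[0,1/s)$. For every prime $p$ sufficiently large in terms of $s$ and $\tau$, there exists a subset $A_p\subseteq(\mathbb{Z}/p)^{(2)}$ with $|A_p|\geq \tau\,|(\mathbb{Z}/p)^{(2)}|$ such that the $s$-fold sumset $sA_p=\{x_1+\dots+x_s: x_i\in A_p\}$ is not equal to $\mathbb{Z}/p$.
   Context: $(\mathbb{Z}/p)^{(2)}$ denotes the set of squares in $\mathbb{Z}/p$ (including $0$). *)

theory Defs
  imports Complex_Main "HOL-Number_Theory.Residues"
begin

definition ring_squares :: "('a, 'm) ring_scheme \<Rightarrow> 'a set" where
  "ring_squares R = {x \<otimes>\<^bsub>R\<^esub> x | x. x \<in> carrier R}"

definition fold_sumset :: "('a, 'm) ring_scheme \<Rightarrow> nat \<Rightarrow> 'a set \<Rightarrow> 'a set" where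
  "fold_sumset R s A = {(\<Oplus>\<^bsub>R\<^esub>i\<in>{..<s}. x i) | x. x \<in> {..<s} \<rightarrow> A}"

end

theory Submission
  imports Defs
begin

text \<open>Take for \<open>A\<close> the squares in an interval of \<open>p div s\<close> consecutive residues. The \<open>s\<close>-fold sumset of
  such an interval lies in an interval of fewer than \<open>p\<close> residues, so it misses a residue. Averaging
  over the translates of the interval, one of them contains at least the average number
  \<open>(p div s) / p\<close> times the number of squares, and \<open>(p div s) / p\<close> tends to \<open>1 / s > \<tau>\<close>.\<close>

lemma (in residues) finsum_eq_sum_mod:
  assumes "finite I" "f \<in> I \<rightarrow> carrier R"
  shows "(\<Oplus>i\<in>I. f i) = (\<Sum>i\<in>I. f i) mod m"
  using assms
proof (induction I rule: finite_induct)
  case empty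
  then show ?case by (simp add: res_zero_eq)
next
  case (insert i I)
  then have "(\<Oplus>i\<in>insert i I. f i) = f i \<oplus> (\<Oplus>i\<in>I. f i)"
    by (intro finsum_insert) auto
  with insert show ?case
    by (simp add: res_add_eq mod_simps)
qed

text \<open>The offset \<open>(x - a) mod m\<close> makes the interval cyclic: it starts at
  \<open>a\<close> and may wrap around past \<open>m - 1\<close>, so all translates have the same
  length.\<close>

definition residues_in_interval :: "int \<Rightarrow> int set \<Rightarrow> int \<Rightarrow> int \<Rightarrow> int set" where
  "residues_in_interval m S L a = {x \<in> S. (x - a) mod m < L}"

lemma card_translates_containing:
  fixes m L x :: int
  assumes "0 < m" "0 \<le> L" "L \<le> m"
  shows "int (card {a \<in> {0..<m}. (x - a) mod m < L}) = L"
proof -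
  have "bij_betw (\<lambda>a. (x - a) mod m) {a \<in> {0..<m}. (x - a) mod m < L} {0..<L}"
    using assms
    \<comment> \<open>Subtracting from \<open>x\<close> modulo \<open>m\<close> is an involution, so
      the map serves as its own inverse.\<close>
    by (intro bij_betw_byWitness[where f' = "\<lambda>r. (x - r) mod m"]) (auto simp: mod_simps)
  then show ?thesis
    using assms by (simp add: bij_betw_same_card)
qed

text \<open>Double counting of the pairs \<open>(a, x)\<close> with \<open>x\<close> in the
  translate at \<open>a\<close>: each \<open>x\<close> lies in exactly \<open>L\<close>
  translates.\<close>

lemma sum_card_residues_in_interval:
  fixes m L :: int
  assumes "0 < m" "0 \<le> L" "L \<le> m" "finite S"
  shows "(\<Sum>a\<in>{0..<m}. int (card (residues_in_interval m S L a))) = int (card S) * L"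
proof -
  have "(\<Sum>a\<in>{0..<m}. card (residues_in_interval m S L a))
      = (\<Sum>x\<in>S. card {a \<in> {0..<m}. (x - a) mod m < L})"
    unfolding residues_in_interval_def
    using assms(4) by (intro sum_multicount_gen) auto
  then have "(\<Sum>a\<in>{0..<m}. int (card (residues_in_interval m S L a)))
      = (\<Sum>x\<in>S. int (card {a \<in> {0..<m}. (x - a) mod m < L}))"
    by (simp only: of_nat_sum [symmetric])
  then show ?thesis
    by (simp only: card_translates_containing[OF assms(1-3)] sum_constant)
qed

text \<open>If all \<open>m\<close> translates fell below the average, their total would contradict
  the double count. Multiplying out by \<open>m\<close> keeps the bound in the integers.\<close>

lemma exists_dense_interval:
  fixes m L :: int
  assumes "0 < m" "0 \<le> L" "L \<le> m" "finite S"
  obtains a where "int (card S) * L \<le> m * int (card (residues_in_interval m S L a))"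
proof -
  have "\<exists>a. int (card S) * L \<le> m * int (card (residues_in_interval m S L a))"
  proof (rule ccontr)
    assume "\<not> ?thesis"
    then have "(\<Sum>a\<in>{0..<m}. m * int (card (residues_in_interval m S L a)))
        < (\<Sum>a\<in>{0..<m}. int (card S) * L)"
      using assms(1) by (intro sum_strict_mono) (auto simp: not_le)
    then show False
      using assms by (simp add: sum_card_residues_in_interval flip: sum_distrib_left)
  qed
  with that show ?thesis by blast
qed

text \<open>Offsets from \<open>a\<close> add up to an offset from \<open>int s * a\<close>, and
  their total is too small to reach all the way round to the residue just before
  \<open>int s * a\<close>.\<close>

lemma (in residues) fold_sumset_interval_neq:
  assumes "2 \<le> s" "int s * L \<le> m" "S \<subseteq> carrier R"
  shows "fold_sumset R s (residues_in_interval m S L a) \<noteq> carrier R"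
proof
  assume "fold_sumset R s (residues_in_interval m S L a) = carrier R"
  \<comment> \<open>This is the missed residue; its offset from \<open>int s * a\<close> is the
    largest possible, \<open>m - 1\<close>.\<close>
  moreover have "(int s * a - 1) mod m \<in> carrier R"
    using m_gt_one by (simp add: res_carrier_eq)
  ultimately obtain x where x: "x \<in> {..<s} \<rightarrow> residues_in_interval m S L a"
    and eq: "(int s * a - 1) mod m = (\<Oplus>i\<in>{..<s}. x i)"
    unfolding fold_sumset_def by blast
  have "x \<in> {..<s} \<rightarrow> carrier R"
    using x assms(3) by (auto simp: residues_in_interval_def Pi_iff)
  then have eq': "(int s * a - 1) mod m = (\<Sum>i<s. x i) mod m"
    using eq by (simp add: finsum_eq_sum_mod)
  define r where "r = (\<Sum>i<s. (x i - a) mod m)"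
  have "r \<le> (\<Sum>i<s. L - 1)"
    unfolding r_def using x
    by (intro sum_mono) (force simp: residues_in_interval_def Pi_iff)
  also have "\<dots> = int s * L - int s"
    by (simp add: algebra_simps)
  \<comment> \<open>The bound is at most \<open>m - s\<close>, and \<open>2 \<le> s\<close> puts
    this strictly below \<open>m - 1\<close>.\<close>
  finally have "r < m - 1"
    using assms by linarith
  moreover have "0 \<le> r"
    unfolding r_def using m_gt_one by (intro sum_nonneg) simp
  \<comment> \<open>The total offset does not wrap around, so its residue class, that of
    \<open>- 1\<close>, would force \<open>r = m - 1\<close>.\<close>
  ultimately have "r = r mod m" by simp
  also have "\<dots> = ((\<Sum>i<s. x i) mod m - int s * a) mod m"
    unfolding r_def by (simp add: mod_sum_eq sum_subtractf mod_simps)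
  also have "\<dots> = (- 1) mod m"
    unfolding eq'[symmetric] by (simp add: mod_simps)
  also have "\<dots> = m - 1"
    using m_gt_one by (simp add: zmod_minus1)
  finally show False
    using \<open>r < m - 1\<close> by simp
qed

lemma (in residues) ring_squares_subset: "ring_squares R \<subseteq> carrier R"
  by (auto simp: ring_squares_def)

theorem theorem1p2:
  fixes s :: nat and \<tau> :: real
  assumes "s \<ge> 5" and "0 \<le> \<tau>" and "\<tau> < 1 / real s"
  shows "\<exists>N::nat. \<forall>p::nat. prime p \<and> p \<ge> N \<longrightarrow>
    (\<exists>A. A \<subseteq> ring_squares (residue_ring (int p)) \<and>
         real (card A) \<ge> \<tau> * real (card (ring_squares (residue_ring (int p)))) \<and>
         fold_sumset (residue_ring (int p)) s A \<noteq> carrier (residue_ring (int p)))"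
proof -
  \<comment> \<open>Chosen so that \<open>p \<ge> N\<close> gives
    \<open>p / s - \<tau> * p \<ge> 1\<close>, which absorbs the loss from rounding
    \<open>p / s\<close> down to \<open>L\<close>.\<close>
  define N where "N = nat \<lceil>1 / (1 / real s - \<tau>)\<rceil>"
  have "\<exists>A. A \<subseteq> ring_squares (residue_ring (int p)) \<and>
         real (card A) \<ge> \<tau> * real (card (ring_squares (residue_ring (int p)))) \<and>
         fold_sumset (residue_ring (int p)) s A \<noteq> carrier (residue_ring (int p))"
    if "prime p" "p \<ge> N" for p :: nat
  proof -
    define R where "R = residue_ring (int p)"
    interpret residues "int p" R
      using prime_gt_1_nat[OF that(1)] by unfold_locales (simp_all add: R_def)
    define S where "S = ring_squares R"
    define L where "L = int (p div s)"
    have "finite S"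
      unfolding S_def by (rule finite_subset[OF ring_squares_subset finite])
    moreover have "0 < int p" "0 \<le> L" "L \<le> int p"
      using m_gt_one by (simp_all add: L_def)
    ultimately obtain a
      where a: "int (card S) * L \<le> int p * int (card (residues_in_interval (int p) S L a))"
      by (metis exists_dense_interval)
    let ?A = "residues_in_interval (int p) S L a"
    have "1 / (1 / real s - \<tau>) \<le> real p"
      using that(2) unfolding N_def by linarith
    then have "1 \<le> real p * (1 / real s - \<tau>)"
      using assms(3) by (simp add: pos_divide_le_eq)
    then have "\<tau> * real p \<le> real p / real s - 1"
      by (simp add: algebra_simps)
    \<comment> \<open>Rounding down costs at most 1.\<close>
    also have "\<dots> \<le> of_int L"
      using real_of_int_div3[of "int p" "int s"] by (simp add: L_def zdiv_int)
    finally have "real (card S) * (\<tau> * real p) \<le> real (card S) * of_int L"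
      by (rule mult_left_mono) simp
    also have "\<dots> \<le> real p * real (card ?A)"
      using a by (metis of_int_le_iff of_int_mult of_int_of_nat_eq)
    finally have "real p * (\<tau> * real (card S)) \<le> real p * real (card ?A)"
      by (simp add: mult_ac)
    then have "\<tau> * real (card S) \<le> real (card ?A)"
      using m_gt_one by simp
    moreover have "?A \<subseteq> S"
      by (auto simp: residues_in_interval_def)
    moreover have "int s * L \<le> int p"
      unfolding L_def by (simp flip: of_nat_mult)
    then have "fold_sumset R s ?A \<noteq> carrier R"
      using assms(1) ring_squares_subset
      by (intro fold_sumset_interval_neq) (auto simp: S_def)
    ultimately show ?thesis
      unfolding S_def R_def by blast
  qed
  then show ?thesis by blast
qed

end
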